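(* Let $p\ge2$ be an integer. There is a constant $C_p>0$ depending only on $p$ such that the following holds. Let $\mathcal X\subseteq\mathbb R^d$ be a nonempty closed bounded convex set with diameter $D=\max_{x,y\in\mathcal X}\|x-y\|$. Let $F:\mathcal X\to\mathbb R^d$ be monotone, i.e. $\langle F(x)-F(y),x-y\rangle\ge0$ for all $x,y\in\mathcal X$, and $(p-1)$-th-order $L_{p-1}$-smooth, i.e. $\|\nabla^{p-1}F(x)-\nabla^{p-1}F(y)\|_{\mathrm{op}}\le L_{p-1}\|x-y\|$ for all $x,y\in\mathcal X$. Let $G_i(v)$ ($1\le i\le p-1$, $v\in\mathcal X$) be inexact $i$-th derivatives of $F$ satisfying, with constants $\delta_i\ge0$, $$\left\|(\nabla^iF(v)-G_i(v))[x-v]^{i-1}\right\|\le\delta_i\|x-v\|^{i-1}\quad\text{for all }x,v\in\mathcal X.$$ Then after $T\ge1$ iterations of the algorithm VIHI with parameters $\eta_i=5p$ for all $i$, the averaged output $\tilde x_T=\frac1{\sum_{k=1}^T\lambda_k}\sum_{k=1}^T\lambda_kx_k$ (option $\mathsf{opt}=0$) satisfies $$\sup_{x\in\mathcal X}\langle F(x),\tilde x_T-x\rangle\le C_p\left(\frac{L_{p-1}D^{p+1}}{T^{\frac{p+1}2}}+\sum_{i=1}^{p-1}\frac{\delta_iD^{i+1}}{T^{\frac{i+1}2}}\right).$$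
   Context: $\|\cdot\|$ is the Euclidean norm, $\|\cdot\|_{\mathrm{op}}$ the operator norm of multilinear maps. $\nabla^iF(v)$ is the $i$-th derivative, viewed as an $i$-linear map $(\mathbb R^d)^i\to\mathbb R^d$; $G_i(v)$ is an $i$-linear map of the same type. $A[h]^i$ means inserting $h$ in all $i$ arguments; $A[h]^{i-1}$ means inserting $h$ in $i-1$ arguments, leaving a linear map $\mathbb R^d\to\mathbb R^d$ whose operator norm is taken. Inexact model: $\Psi_{p,v}(x)=F(v)+\sum_{i=1}^{p-1}\frac1{i!}G_i(v)[x-v]^i$ and $$\Omega_{p,v}(x)=\Psi_{p,v}(x)+\sum_{i=1}^{p-1}\frac{\eta_i\delta_i}{i!}\|x-v\|^{i-1}(x-v)+\frac{5L_{p-1}}{(p-1)!}\|x-v\|^{p-1}(x-v).$$ Algorithm VIHI: given $x_0\in\mathcal X$, set $s_0=0\in\mathbb R^d$ and for $k=0,1,2,\dots$: (1) $v_{k+1}=\arg\max_{v\in\mathcal X}\{\langle s_k,v-x_0\rangle-\frac12\|v-x_0\|^2\}$; (2) $x_{k+1}\in\mathcal X$ is any point with $\sup_{x\in\mathcal X}\langle\Omega_{p,v_{k+1}}(x_{k+1}),x_{k+1}-x\rangle\le\frac{L_{p-1}}{p!}\|x_{k+1}-v_{k+1}\|^{p+1}+\sum_{i=1}^{p-1}\frac{\delta_i}{i!}\|x_{k+1}-v_{k+1}\|^{i+1}$; (3) $\lambda_{k+1}$ is any number with $\frac1{4(5p-2)}\le\lambda_{k+1}\left(\frac{L_{p-1}}{p!}\|x_{k+1}-v_{k+1}\|^{p-1}+\sum_{i=1}^{p-1}\frac{\delta_i}{i!}\|x_{k+1}-v_{k+1}\|^{i-1}\right)\le\frac1{2(5p+1)}$;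 (4) $s_{k+1}=s_k-\lambda_{k+1}F(x_{k+1})$. *)

theory Defs
  imports "HOL-Analysis.Analysis" "HOL-Library.Poly_Mapping"
begin

(* The constant of the theorem must not depend on the dimension d, so d is a natural number that
   is quantified inside the statement rather than an index type.  All the spaces R^d live in the
   type of finitely supported real sequences with the inner product (SUM k. x_k * y_k); R^d is
   the subspace of sequences vanishing from index d on (compare topspace_Euclidean_space).
   Norm, distance, topology and diameter are then those of the type class real_inner,
   and on R^d they are the Euclidean ones. *)

instantiation poly_mapping :: (type, real_vector) real_vector
begin

lift_definition scaleR_poly_mapping :: "real \<Rightarrow> ('a \<Rightarrow>\<^sub>0 'b) \<Rightarrow> 'a \<Rightarrow>\<^sub>0 'b"
  is "\<lambda>r f k. r *\<^sub>R f k"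
  by (rule finite_subset) auto

instance
proof
  fix x y :: "'a \<Rightarrow>\<^sub>0 'b" and a b :: real
  show "a *\<^sub>R (x + y) = a *\<^sub>R x + a *\<^sub>R y"
    by (rule poly_mapping_eqI)
      (simp add: lookup_add scaleR_poly_mapping.rep_eq scaleR_add_right)
  show "(a + b) *\<^sub>R x = a *\<^sub>R x + b *\<^sub>R x"
    by (rule poly_mapping_eqI)
      (simp add: lookup_add scaleR_poly_mapping.rep_eq scaleR_add_left)
  show "a *\<^sub>R b *\<^sub>R x = (a * b) *\<^sub>R x"
    by (rule poly_mapping_eqI) (simp add: scaleR_poly_mapping.rep_eq)
  show "1 *\<^sub>R x = x"
    by (rule poly_mapping_eqI) (simp add: scaleR_poly_mapping.rep_eq)
qed

end

instantiation poly_mapping :: (type, real_inner) real_inner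
begin

definition inner_poly_mapping :: "('a \<Rightarrow>\<^sub>0 'b) \<Rightarrow> ('a \<Rightarrow>\<^sub>0 'b) \<Rightarrow> real"
  where "inner_poly_mapping x y = (\<Sum>k\<in>Poly_Mapping.keys x. Poly_Mapping.lookup x k \<bullet> Poly_Mapping.lookup y k)"

definition norm_poly_mapping :: "('a \<Rightarrow>\<^sub>0 'b) \<Rightarrow> real"
  where "norm_poly_mapping x = sqrt (x \<bullet> x)"

definition sgn_poly_mapping :: "('a \<Rightarrow>\<^sub>0 'b) \<Rightarrow> 'a \<Rightarrow>\<^sub>0 'b"
  where "sgn_poly_mapping x = x /\<^sub>R norm x"

definition dist_poly_mapping :: "('a \<Rightarrow>\<^sub>0 'b) \<Rightarrow> ('a \<Rightarrow>\<^sub>0 'b) \<Rightarrow> real"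
  where "dist_poly_mapping x y = norm (x - y)"

definition uniformity_poly_mapping :: "(('a \<Rightarrow>\<^sub>0 'b) \<times> ('a \<Rightarrow>\<^sub>0 'b)) filter"
  where "uniformity_poly_mapping = (INF e\<in>{0<..}. principal {(x, y). dist x y < e})"

definition open_poly_mapping :: "('a \<Rightarrow>\<^sub>0 'b) set \<Rightarrow> bool"
  where "open_poly_mapping U \<longleftrightarrow>
    (\<forall>x\<in>U. \<forall>\<^sub>F (x', y) in uniformity. x' = x \<longrightarrow> y \<in> U)"

lemma inner_poly_mapping_superset:
  fixes x y :: "'a \<Rightarrow>\<^sub>0 'b"
  assumes "finite A" "Poly_Mapping.keys x \<subseteq> A"
  shows "x \<bullet> y = (\<Sum>k\<in>A. Poly_Mapping.lookup x k \<bullet> Poly_Mapping.lookup y k)"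
  unfolding inner_poly_mapping_def
  by (rule sum.mono_neutral_left) (use assms in \<open>auto simp: in_keys_iff\<close>)

instance
proof
  fix x y z :: "'a \<Rightarrow>\<^sub>0 'b" and r :: real
  show "dist x y = norm (x - y)" by (rule dist_poly_mapping_def)
  show "sgn x = x /\<^sub>R norm x" by (rule sgn_poly_mapping_def)
  show "uniformity = (INF e\<in>{0<..}. principal {(x, y :: 'a \<Rightarrow>\<^sub>0 'b). dist x y < e})"
    by (rule uniformity_poly_mapping_def)
  show "open U \<longleftrightarrow> (\<forall>x\<in>U. \<forall>\<^sub>F (x', y) in uniformity. x' = x \<longrightarrow> y \<in> U)"
    for U :: "('a \<Rightarrow>\<^sub>0 'b) set"
    by (rule open_poly_mapping_def)
  show "norm x = sqrt (x \<bullet> x)" by (rule norm_poly_mapping_def)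
  define K where "K = Poly_Mapping.keys x \<union> Poly_Mapping.keys y \<union> Poly_Mapping.keys z \<union> Poly_Mapping.keys (x + y) \<union> Poly_Mapping.keys (r *\<^sub>R x)"
  have K: "finite K" "Poly_Mapping.keys x \<subseteq> K" "Poly_Mapping.keys y \<subseteq> K" "Poly_Mapping.keys (x + y) \<subseteq> K" "Poly_Mapping.keys (r *\<^sub>R x) \<subseteq> K"
    by (auto simp: K_def)
  show "x \<bullet> y = y \<bullet> x"
    by (simp add: inner_poly_mapping_superset[OF K(1,2)]
        inner_poly_mapping_superset[OF K(1,3)] inner_commute)
  show "(x + y) \<bullet> z = x \<bullet> z + y \<bullet> z"
    by (simp add: inner_poly_mapping_superset[OF K(1,2)] inner_poly_mapping_superset[OF K(1,3)]
        inner_poly_mapping_superset[OF K(1,4)] lookup_add inner_add_left sum.distrib)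
  show "(r *\<^sub>R x) \<bullet> y = r * (x \<bullet> y)"
    by (simp add: inner_poly_mapping_superset[OF K(1,2)] inner_poly_mapping_superset[OF K(1,5)]
        scaleR_poly_mapping.rep_eq sum_distrib_left)
  show "0 \<le> x \<bullet> x" by (simp add: inner_poly_mapping_def sum_nonneg)
  show "x \<bullet> x = 0 \<longleftrightarrow> x = 0"
    by (auto simp: inner_poly_mapping_def sum_nonneg_eq_0_iff in_keys_iff
        intro!: poly_mapping_eqI)
qed

end

type_synonym rvec = "nat \<Rightarrow>\<^sub>0 real"

definition Rd :: "nat \<Rightarrow> rvec set"
  where "Rd d = {x. \<forall>k\<ge>d. Poly_Mapping.lookup x k = 0}"

lemma subspace_Rd: "subspace (Rd d)"
  by (auto simp: subspace_def Rd_def lookup_add scaleR_poly_mapping.rep_eq)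

lemma inner_Rd:
  assumes "x \<in> Rd d"
  shows "x \<bullet> y = (\<Sum>k<d. Poly_Mapping.lookup x k * Poly_Mapping.lookup y k)"
proof -
  have "Poly_Mapping.keys x \<subseteq> {..<d}"
    using assms by (auto simp: Rd_def in_keys_iff not_le[symmetric])
  then show ?thesis
    by (simp add: inner_poly_mapping_superset[of "{..<d}"])
qed

(* An i-linear map (R^d)^i -> R^d is a function on lists; only its values on lists of length i
   with entries in R^d matter. *)
definition multilinear :: "nat \<Rightarrow> nat \<Rightarrow> (rvec list \<Rightarrow> rvec) \<Rightarrow> bool"
  where "multilinear d i A \<longleftrightarrow>
    (\<forall>hs. length hs = i \<and> set hs \<subseteq> Rd d \<longrightarrow>
       A hs \<in> Rd d \<and>
       (\<forall>j<i. \<forall>x\<in>Rd d. \<forall>y\<in>Rd d. \<forall>a b.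
          A (hs[j := a *\<^sub>R x + b *\<^sub>R y]) = a *\<^sub>R A (hs[j := x]) + b *\<^sub>R A (hs[j := y])))"

definition op_norm :: "nat \<Rightarrow> nat \<Rightarrow> (rvec list \<Rightarrow> rvec) \<Rightarrow> real"
  where "op_norm d i A =
    Sup {norm (A hs) | hs. length hs = i \<and> set hs \<subseteq> Rd d \<and> (\<forall>h\<in>set hs. norm h \<le> 1)}"

(* D i v plays the role of the i-th derivative of F at v, for i up to m.  Derivatives are Frechet
   derivatives within X (F is only given on X), with values in the i-linear maps normed by
   op_norm; the direction of differentiation is the first argument of D (Suc i). *)
definition derivatives ::
  "nat \<Rightarrow> rvec set \<Rightarrow> nat \<Rightarrow> (rvec \<Rightarrow> rvec) \<Rightarrow> (nat \<Rightarrow> rvec \<Rightarrow> rvec list \<Rightarrow> rvec) \<Rightarrow> bool"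
  where "derivatives d X m F D \<longleftrightarrow>
    (\<forall>v\<in>X. D 0 v [] = F v) \<and>
    (\<forall>i\<le>m. \<forall>v\<in>X. multilinear d i (D i v)) \<and>
    (\<forall>i<m. \<forall>v\<in>X.
       ((\<lambda>y. op_norm d i (\<lambda>hs. D i y hs - D i v hs - D (Suc i) v ((y - v) # hs)) / norm (y - v))
          \<longlongrightarrow> 0) (at v within X))"

definition Psi ::
  "(rvec \<Rightarrow> rvec) \<Rightarrow> (nat \<Rightarrow> rvec \<Rightarrow> rvec list \<Rightarrow> rvec) \<Rightarrow> nat \<Rightarrow> rvec \<Rightarrow> rvec \<Rightarrow> rvec"
  where "Psi F G p v x =
    F v + (\<Sum>i=1..p-1. (1 / fact i) *\<^sub>R G i v (replicate i (x - v)))"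

definition Omega ::
  "(rvec \<Rightarrow> rvec) \<Rightarrow> (nat \<Rightarrow> rvec \<Rightarrow> rvec list \<Rightarrow> rvec) \<Rightarrow> real \<Rightarrow> (nat \<Rightarrow> real) \<Rightarrow> (nat \<Rightarrow> real)
    \<Rightarrow> nat \<Rightarrow> rvec \<Rightarrow> rvec \<Rightarrow> rvec"
  where "Omega F G L \<delta> \<eta> p v x =
    Psi F G p v x
    + (\<Sum>i=1..p-1. (\<eta> i * \<delta> i / fact i * norm (x - v) ^ (i - 1)) *\<^sub>R (x - v))
    + (5 * L / fact (p - 1) * norm (x - v) ^ (p - 1)) *\<^sub>R (x - v)"

(* T iterations of VIHI with starting point x 0; the entries v 0 and lam 0 are unused. *)
definition VIHI ::
  "rvec set \<Rightarrow> (rvec \<Rightarrow> rvec) \<Rightarrow> (nat \<Rightarrow> rvec \<Rightarrow> rvec list \<Rightarrow> rvec) \<Rightarrow> real \<Rightarrow> (nat \<Rightarrow> real) \<Rightarrow> (nat \<Rightarrow> real)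
    \<Rightarrow> nat \<Rightarrow> nat \<Rightarrow> (nat \<Rightarrow> rvec) \<Rightarrow> (nat \<Rightarrow> rvec) \<Rightarrow> (nat \<Rightarrow> rvec) \<Rightarrow> (nat \<Rightarrow> real) \<Rightarrow> bool"
  where "VIHI X F G L \<delta> \<eta> p T x v s lam \<longleftrightarrow>
    x 0 \<in> X \<and> s 0 = 0 \<and>
    (\<forall>k<T.
       is_arg_max (\<lambda>u. s k \<bullet> (u - x 0) - 1/2 * norm (u - x 0) ^ 2) (\<lambda>u. u \<in> X) (v (Suc k)) \<and>
       x (Suc k) \<in> X \<and>
       (SUP y\<in>X. Omega F G L \<delta> \<eta> p (v (Suc k)) (x (Suc k)) \<bullet> (x (Suc k) - y))
         \<le> L / fact p * norm (x (Suc k) - v (Suc k)) ^ (p + 1)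
           + (\<Sum>i=1..p-1. \<delta> i / fact i * norm (x (Suc k) - v (Suc k)) ^ (i + 1)) \<and>
       1 / (4 * (5 * real p - 2))
         \<le> lam (Suc k) * (L / fact p * norm (x (Suc k) - v (Suc k)) ^ (p - 1)
           + (\<Sum>i=1..p-1. \<delta> i / fact i * norm (x (Suc k) - v (Suc k)) ^ (i - 1))) \<and>
       lam (Suc k) * (L / fact p * norm (x (Suc k) - v (Suc k)) ^ (p - 1)
           + (\<Sum>i=1..p-1. \<delta> i / fact i * norm (x (Suc k) - v (Suc k)) ^ (i - 1)))
         \<le> 1 / (2 * (5 * real p + 1)) \<and>
       s (Suc k) = s k - lam (Suc k) *\<^sub>R F (x (Suc k)))"

definition averaged_output :: "nat \<Rightarrow> (nat \<Rightarrow> rvec) \<Rightarrow> (nat \<Rightarrow> real) \<Rightarrow> rvec"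
  where "averaged_output T x lam = (1 / (\<Sum>k=1..T. lam k)) *\<^sub>R (\<Sum>k=1..T. lam k *\<^sub>R x k)"

end

theory Submission
  imports Defs
begin

text \<open>
  Write \<open>r k\<close> for the length \<open>norm (x k - v k)\<close> of the \<open>k\<close>-th step and \<open>\<theta>\<close> for the polynomial
  \<open>\<theta> r = L / fact p * r ^ (p - 1) + (\<Sum>i=1..p-1. \<delta> i / fact i * r ^ (i - 1))\<close>.  The algorithm is
  tuned so that everything is measured by this one quantity.  By Taylor's theorem along the
  segment from \<open>v k\<close> to \<open>x k\<close> the model \<open>Psi\<close> differs from \<open>F (x k)\<close> by at most \<open>\<theta> (r k) * r k\<close>
  (\<open>inexact_model_error\<close>); the regularisation in \<open>Omega\<close> is exactly \<open>5 p \<theta> (r k)\<close> times \<open>x k - v k\<close>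
  (\<open>Omega_eq_step_scale\<close>); the subproblem is solved up to \<open>\<theta> (r k) * (r k)\<^sup>2\<close>; and the condition
  on the step size fixes \<open>lam k * \<theta> (r k)\<close> up to a constant factor.

  Hence one step costs, against any competitor \<open>w\<close>, at most
  \<open>norm (w - v k)\<^sup>2 / 2 - (r k)\<^sup>2 / 8\<close> (\<open>regularized_step_progress\<close>).  The first term is what the
  strongly concave maximisation defining \<open>v k\<close> gives back, so the costs telescope
  (\<open>dual_extrapolation_regret\<close>) and, with \<open>D\<close> the diameter,
  \<open>(\<Sum>k=1..T. lam k * (F (x k) \<bullet> (x k - w)) + (r k)\<^sup>2 / 8) \<le> D\<^sup>2 / 2\<close> for every \<open>w\<close> in \<open>X\<close>.

  By monotonicity the left-hand side dominates the gap at \<open>w\<close> of the averaged output, times the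
  total weight \<open>\<Sum>k. lam k\<close>.  Choosing \<open>w\<close> to be the averaged output itself removes the gap and
  leaves \<open>\<Sum>k. (r k)\<^sup>2 \<le> 4 D\<^sup>2\<close>
  (\<open>weighted_average_gap\<close>).  So most steps are no longer than \<open>3 D / sqrt T\<close>, and the weight of such
  a step is at least a constant over \<open>\<theta> (3 D / sqrt T)\<close>; the total weight is therefore at least of
  order \<open>T / \<theta> (3 D / sqrt T)\<close> (\<open>sum_stepsizes_lower_bound\<close>).  Dividing \<open>D\<^sup>2 / 2\<close> by it gives
  \<open>4 (5 p - 2) * (D\<^sup>2 / T) * \<theta> (3 D / sqrt T)\<close>, and each term of \<open>\<theta>\<close> turns into one term of the
  claimed rate (\<open>rate_term\<close>), with constant \<open>4 (5 p - 2) * 3 ^ p\<close>.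
\<close>

section \<open>Multilinear maps and their operator norm\<close>

lemma abs_lookup_le_norm: "\<bar>Poly_Mapping.lookup h k\<bar> \<le> norm h" for h :: rvec
proof -
  have "(Poly_Mapping.lookup h k)\<^sup>2
      \<le> (\<Sum>j\<in>insert k (Poly_Mapping.keys h). (Poly_Mapping.lookup h j)\<^sup>2)"
    by (rule member_le_sum) auto
  also have "\<dots> = h \<bullet> h"
    by (subst inner_poly_mapping_superset[of "insert k (Poly_Mapping.keys h)"])
      (auto simp: power2_eq_square)
  also have "\<dots> = (norm h)\<^sup>2"
    by (rule dot_square_norm)
  finally show ?thesis
    by (metis abs_le_square_iff abs_norm_cancel)
qed

definition unit_vec :: "nat \<Rightarrow> rvec"
  where "unit_vec k = Poly_Mapping.single k 1"

lemma unit_vec_in_Rd: "k < d \<Longrightarrow> unit_vec k \<in> Rd d"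
  by (auto simp: Rd_def unit_vec_def lookup_single when_def)

lemma Rd_expansion:
  assumes "h \<in> Rd d"
  shows "h = (\<Sum>k<d. Poly_Mapping.lookup h k *\<^sub>R unit_vec k)"
proof (rule poly_mapping_eqI)
  fix j
  have "Poly_Mapping.lookup (\<Sum>k<d. Poly_Mapping.lookup h k *\<^sub>R unit_vec k) j
      = (\<Sum>k<d. if k = j then Poly_Mapping.lookup h k else 0)"
    by (simp add: lookup_sum scaleR_poly_mapping.rep_eq unit_vec_def lookup_single when_def
        if_distrib cong: if_cong)
  also have "\<dots> = Poly_Mapping.lookup h j"
    using assms by (auto simp: Rd_def)
  finally show "Poly_Mapping.lookup h j
      = Poly_Mapping.lookup (\<Sum>k<d. Poly_Mapping.lookup h k *\<^sub>R unit_vec k) j" ..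
qed

lemma multilinear_in_Rd:
  "multilinear d i A \<Longrightarrow> length hs = i \<Longrightarrow> set hs \<subseteq> Rd d \<Longrightarrow> A hs \<in> Rd d"
  by (auto simp: multilinear_def)

lemma multilinear_update:
  assumes "multilinear d i A" "length hs = i" "set hs \<subseteq> Rd d" "j < i" "x \<in> Rd d" "y \<in> Rd d"
  shows "A (hs[j := a *\<^sub>R x + b *\<^sub>R y]) = a *\<^sub>R A (hs[j := x]) + b *\<^sub>R A (hs[j := y])"
  using assms unfolding multilinear_def by blast

lemma multilinear_head:
  assumes "multilinear d (Suc i) A" "length hs = i" "set hs \<subseteq> Rd d" "x \<in> Rd d" "y \<in> Rd d"
  shows "A ((a *\<^sub>R x + b *\<^sub>R y) # hs) = a *\<^sub>R A (x # hs) + b *\<^sub>R A (y # hs)"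
  using multilinear_update[OF assms(1), of "x # hs" 0 x y a b] assms by auto

lemma multilinear_append:
  assumes B: "multilinear d (n + i) B" and pre: "length us = n" "set us \<subseteq> Rd d"
  shows "multilinear d i (\<lambda>hs. B (us @ hs))"
  unfolding multilinear_def
proof (intro allI impI conjI ballI)
  fix hs assume hs: "length hs = i \<and> set hs \<subseteq> Rd d"
  have *: "length (us @ hs) = n + i" "set (us @ hs) \<subseteq> Rd d"
    using hs pre by auto
  show "B (us @ hs) \<in> Rd d"
    by (rule multilinear_in_Rd[OF B *])
  fix j x y a b assume j: "j < i" and xy: "x \<in> Rd d" "y \<in> Rd d"
  have "us @ hs[j := z] = (us @ hs)[n + j := z]" for z
    using pre by (simp add: list_update_append)
  then show "B (us @ hs[j := a *\<^sub>R x + b *\<^sub>R y])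
      = a *\<^sub>R B (us @ hs[j := x]) + b *\<^sub>R B (us @ hs[j := y])"
    using multilinear_update[OF B * _ xy, of "n + j" a b] j by simp
qed

lemma multilinear_Cons:
  "multilinear d (Suc i) A \<Longrightarrow> h \<in> Rd d \<Longrightarrow> multilinear d i (\<lambda>hs. A (h # hs))"
  using multilinear_append[of d 1 i A "[h]"] by simp

lemma multilinear_diff:
  assumes "multilinear d i A" "multilinear d i B"
  shows "multilinear d i (\<lambda>hs. A hs - B hs)"
  unfolding multilinear_def
proof (intro allI impI conjI ballI)
  fix hs assume hs: "length hs = i \<and> set hs \<subseteq> Rd d"
  then show "A hs - B hs \<in> Rd d"
    using assms by (simp add: multilinear_in_Rd subspace_diff[OF subspace_Rd])
  fix j x y a b assume "j < i" "x \<in> Rd d" "y \<in> Rd d"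
  then show "A (hs[j := a *\<^sub>R x + b *\<^sub>R y]) - B (hs[j := a *\<^sub>R x + b *\<^sub>R y])
      = a *\<^sub>R (A (hs[j := x]) - B (hs[j := x])) + b *\<^sub>R (A (hs[j := y]) - B (hs[j := y]))"
    using hs assms by (simp add: multilinear_update algebra_simps)
qed

lemma multilinear_head_sum:
  assumes A: "multilinear d (Suc i) A" and hs: "length hs = i" "set hs \<subseteq> Rd d"
    and e: "\<And>k. k \<in> K \<Longrightarrow> e k \<in> Rd d" and K: "finite K"
  shows "A ((\<Sum>k\<in>K. c k *\<^sub>R e k) # hs) = (\<Sum>k\<in>K. c k *\<^sub>R A (e k # hs))"
  using K e
proof (induction K rule: finite_induct)
  case empty
  show ?case
    using multilinear_head[OF A hs, of 0 0 0 0] by (simp add: subspace_0[OF subspace_Rd])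
next
  case (insert k K)
  have "(\<Sum>k\<in>K. c k *\<^sub>R e k) \<in> Rd d"
    using insert.prems by (intro subspace_sum subspace_scale subspace_Rd) auto
  with insert multilinear_head[OF A hs, of "e k" "\<Sum>k\<in>K. c k *\<^sub>R e k" "c k" 1]
  show ?case by simp
qed

text \<open>
  \<^const>\<open>op_norm\<close> is a supremum of reals, so it controls the values of a map only because a
  multilinear map on a finite-dimensional space is bounded on the unit ball: expanding the first
  argument in unit vectors reduces the number of arguments by one.
\<close>

lemma multilinear_bounded:
  assumes "multilinear d i A"
  shows "\<exists>B. \<forall>hs. length hs = i \<and> set hs \<subseteq> Rd d \<and> (\<forall>h\<in>set hs. norm h \<le> 1) \<longrightarrow> norm (A hs) \<le> B"
  using assms
proof (induction i arbitrary: A)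
  case 0
  then show ?case by auto
next
  case (Suc i)
  have "\<forall>k<d. \<exists>B. \<forall>hs. length hs = i \<and> set hs \<subseteq> Rd d \<and> (\<forall>h\<in>set hs. norm h \<le> 1)
      \<longrightarrow> norm (A (unit_vec k # hs)) \<le> B"
    using Suc.IH multilinear_Cons[OF Suc.prems unit_vec_in_Rd] by blast
  then obtain B where B: "norm (A (unit_vec k # hs)) \<le> B k"
    if "k < d" "length hs = i" "set hs \<subseteq> Rd d" "\<forall>h\<in>set hs. norm h \<le> 1" for k hs
    by metis
  have "norm (A hs) \<le> (\<Sum>k<d. B k)"
    if hs: "length hs = Suc i" "set hs \<subseteq> Rd d" "\<forall>h\<in>set hs. norm h \<le> 1" for hs
  proof -
    obtain h hs' where hs_eq: "hs = h # hs'" using hs by (cases hs) auto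
    have h: "h \<in> Rd d" "norm h \<le> 1" and hs': "length hs' = i" "set hs' \<subseteq> Rd d" "\<forall>h\<in>set hs'. norm h \<le> 1"
      using hs hs_eq by auto
    have "A hs = A ((\<Sum>k<d. Poly_Mapping.lookup h k *\<^sub>R unit_vec k) # hs')"
      using Rd_expansion[OF h(1)] hs_eq by simp
    also have "\<dots> = (\<Sum>k<d. Poly_Mapping.lookup h k *\<^sub>R A (unit_vec k # hs'))"
      by (rule multilinear_head_sum[OF Suc.prems hs'(1,2)]) (auto simp: unit_vec_in_Rd)
    also have "norm \<dots> \<le> (\<Sum>k<d. B k)"
    proof (rule sum_norm_le)
      fix k assume "k \<in> {..<d}"
      then have "norm (A (unit_vec k # hs')) \<le> B k" using B hs' by auto
      moreover have "\<bar>Poly_Mapping.lookup h k\<bar> \<le> 1"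
        using abs_lookup_le_norm[of h k] h by linarith
      ultimately show "norm (Poly_Mapping.lookup h k *\<^sub>R A (unit_vec k # hs')) \<le> B k"
        using mult_mono[of "\<bar>Poly_Mapping.lookup h k\<bar>" 1 "norm (A (unit_vec k # hs'))" "B k"] by simp
    qed
    finally show ?thesis .
  qed
  then show ?case by blast
qed

lemma norm_le_op_norm:
  assumes A: "multilinear d i A"
    and hs: "length hs = i" "set hs \<subseteq> Rd d" "\<And>h. h \<in> set hs \<Longrightarrow> norm h \<le> 1"
  shows "norm (A hs) \<le> op_norm d i A"
  unfolding op_norm_def
proof (rule cSup_upper)
  show "norm (A hs) \<in> {norm (A hs) |hs. length hs = i \<and> set hs \<subseteq> Rd d \<and> (\<forall>h\<in>set hs. norm h \<le> 1)}"
    using hs by blast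
  show "bdd_above {norm (A hs) |hs. length hs = i \<and> set hs \<subseteq> Rd d \<and> (\<forall>h\<in>set hs. norm h \<le> 1)}"
    using multilinear_bounded[OF A] unfolding bdd_above_def by blast
qed

lemma op_norm_nonneg:
  assumes "multilinear d i A"
  shows "0 \<le> op_norm d i A"
proof -
  have "norm (A (replicate i 0)) \<le> op_norm d i A"
    by (rule norm_le_op_norm[OF assms]) (auto simp: subspace_0[OF subspace_Rd])
  then show ?thesis
    using norm_ge_zero order_trans by blast
qed

lemma multilinear_diagonal_scale:
  assumes "multilinear d i A" "h \<in> Rd d"
  shows "A (replicate i (c *\<^sub>R h)) = c ^ i *\<^sub>R A (replicate i h)"
  using assms(1)
proof (induction i arbitrary: A)
  case (Suc i)
  have ch: "c *\<^sub>R h \<in> Rd d" by (intro subspace_scale subspace_Rd assms)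
  have "A (replicate (Suc i) (c *\<^sub>R h)) = c ^ i *\<^sub>R A ((c *\<^sub>R h + 0 *\<^sub>R h) # replicate i h)"
    using Suc.IH[OF multilinear_Cons[OF Suc.prems ch]] by simp
  also have "\<dots> = c ^ i *\<^sub>R (c *\<^sub>R A (h # replicate i h) + 0 *\<^sub>R A (h # replicate i h))"
    using multilinear_head[OF Suc.prems, of "replicate i h" h h c 0] assms by (simp add: set_replicate_conv_if)
  finally show ?case by (simp add: mult.commute)
qed simp

lemma norm_diagonal_le:
  assumes A: "multilinear d i A" and h: "h \<in> Rd d"
  shows "norm (A (replicate i h)) \<le> op_norm d i A * norm h ^ i"
proof -
  define e where "e = (1 / norm h) *\<^sub>R h"
  have e: "e \<in> Rd d" "norm e \<le> 1" "h = norm h *\<^sub>R e"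
    by (auto simp: e_def h intro!: subspace_scale subspace_Rd)
  have "norm (A (replicate i h)) = norm h ^ i * norm (A (replicate i e))"
    using multilinear_diagonal_scale[OF A e(1), of "norm h"] e(3) by (simp flip: e(3))
  also have "\<dots> \<le> norm h ^ i * op_norm d i A"
    using e by (intro mult_left_mono norm_le_op_norm[OF A]) auto
  finally show ?thesis by (simp add: mult.commute)
qed

section \<open>Taylor expansion and the error of the inexact model\<close>

text \<open>
  The remainder is estimated by the mean value inequality and not by an integral, because the
  target space need not be complete: the derivative of the remainder of order \<open>m + 1\<close> is the
  remainder of order \<open>m\<close> of the derivative, and the bound for the latter is the derivative of
  the bound for the former.
\<close>

lemma taylor_remainder_le:
  fixes f :: "nat \<Rightarrow> real \<Rightarrow> 'a::real_normed_vector"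
  assumes deriv: "\<And>i t. i < m \<Longrightarrow> t \<in> {0..1} \<Longrightarrow>
      (f i has_vector_derivative f (Suc i) t) (at t within {0..1})"
    and top: "\<And>t. t \<in> {0..1} \<Longrightarrow> norm (f m t - f m 0) \<le> K * t"
    and t: "t \<in> {0..1}"
  shows "norm (f 0 t - (\<Sum>i\<le>m. (t ^ i / fact i) *\<^sub>R f i 0)) \<le> K * t ^ Suc m / fact (Suc m)"
  using assms
proof (induction m arbitrary: f t)
  case 0
  then show ?case by simp
next
  case (Suc m)
  define R where "R t = f 0 t - (\<Sum>i\<le>Suc m. (t ^ i / fact i) *\<^sub>R f i 0)" for t
  define R' where "R' t = f 1 t - (\<Sum>i\<le>m. (t ^ i / fact i) *\<^sub>R f (Suc i) 0)" for t
  have R'_le: "norm (R' t) \<le> K * t ^ Suc m / fact (Suc m)" if "t \<in> {0..1}" for t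
    unfolding R'_def using Suc.IH[of "\<lambda>i. f (Suc i)" t] Suc.prems(1,2) that by simp
  have R_eq: "R = (\<lambda>t. f 0 t - (f 0 0 + (\<Sum>i\<le>m. (t ^ Suc i / fact (Suc i)) *\<^sub>R f (Suc i) 0)))"
    unfolding R_def by (subst sum.atMost_Suc_shift) simp
  have mono: "((\<lambda>t. t ^ Suc i / fact (Suc i)) has_real_derivative t ^ i / fact i) (at t within S)"
    for i :: nat and t :: real and S
  proof -
    have eq: "real (Suc i) * t ^ (Suc i - Suc 0) / fact (Suc i) = t ^ i / fact i"
      unfolding fact_Suc diff_Suc_Suc diff_zero by (rule mult_divide_mult_cancel_left) simp
    show ?thesis
      using DERIV_cdivide[OF DERIV_pow[of "Suc i" t S], of "fact (Suc i)"] unfolding eq .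
  qed
  have R_deriv: "(R has_vector_derivative R' t) (at t within {0..1})" if "t \<in> {0..1}" for t
  proof -
    have "((\<lambda>t. (t ^ Suc i / fact (Suc i)) *\<^sub>R f (Suc i) 0) has_vector_derivative
        (t ^ i / fact i) *\<^sub>R f (Suc i) 0) (at t within {0..1})" for i
      using has_vector_derivative_scaleR[OF mono has_vector_derivative_const] by simp
    then have "(R has_vector_derivative
        f (Suc 0) t - (0 + (\<Sum>i\<le>m. (t ^ i / fact i) *\<^sub>R f (Suc i) 0))) (at t within {0..1})"
      unfolding R_eq using Suc.prems(1)[of 0 t] that
      by (intro has_vector_derivative_diff has_vector_derivative_add has_vector_derivative_sum
          has_vector_derivative_const) auto
    then show ?thesis by (simp add: R'_def)
  qed
  define \<phi> where "\<phi> t = K * (t ^ Suc (Suc m) / fact (Suc (Suc m)))" for t :: real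
  have phi_deriv: "(\<phi> has_real_derivative K * (t ^ Suc m / fact (Suc m))) (at t)" for t
    unfolding \<phi>_def by (rule DERIV_cmult[OF mono])
  have "norm (R t - R 0) \<le> \<phi> t - \<phi> 0"
  proof (cases "t = 0")
    case False
    with Suc.prems(3) have t: "0 < t" "t \<le> 1" by auto
    show ?thesis
    proof (rule differentiable_bound_general[where f = R and \<phi> = \<phi> and a = 0 and b = t, OF t(1)])
      show "continuous_on {0..t} R"
      proof (rule continuous_on_subset)
        show "continuous_on {0..1} R"
          unfolding continuous_on_eq_continuous_within
          using has_vector_derivative_continuous[OF R_deriv] by blast
        show "{0..t} \<subseteq> {0..1}" using t by simp
      qed
      show "continuous_on {0..t} \<phi>"
        unfolding \<phi>_def by (intro continuous_intros) simp
      fix u assume u: "0 < u" "u < t"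
      have "at u within {0..1} = at u"
        using u t by (intro at_within_interior) auto
      then show "(R has_vector_derivative R' u) (at u)"
        using R_deriv[of u] u t by simp
      show "(\<phi> has_vector_derivative K * (u ^ Suc m / fact (Suc m))) (at u)"
        using phi_deriv has_real_derivative_iff_has_vector_derivative by blast
      show "norm (R' u) \<le> K * (u ^ Suc m / fact (Suc m))"
        using R'_le[of u] u t by simp
    qed
  qed simp
  moreover have "R 0 = 0" by (simp add: R_eq)
  ultimately show ?case by (simp add: R_def \<phi>_def)
qed

text \<open>
  The direction of differentiation occupies the first argument of \<open>D (Suc i)\<close>, so along a segment
  every further derivative just puts one more copy of the direction \<open>h\<close> in front.  Convergence in
  \<^const>\<open>op_norm\<close> controls the diagonal values with the weight \<open>norm h ^ i\<close>, which is constant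
  along the segment.
\<close>

lemma derivative_along_segment:
  assumes D: "derivatives d X m F D" and X: "X \<subseteq> Rd d" "convex X"
    and vx: "v \<in> X" "x \<in> X" and i: "i < m" and t: "t \<in> {0..1}"
  defines "h \<equiv> x - v"
  shows "((\<lambda>t. D i (v + t *\<^sub>R h) (replicate i h)) has_vector_derivative
      D (Suc i) (v + t *\<^sub>R h) (replicate (Suc i) h)) (at t within {0..1})"
proof (cases "h = 0")
  case True
  have ml: "multilinear d (Suc i) (D (Suc i) v)"
    using D i vx by (auto simp: derivatives_def)
  have "D (Suc i) v (replicate (Suc i) h) = 0"
    using multilinear_diagonal_scale[OF ml, of h 0] True by (simp add: subspace_0[OF subspace_Rd])
  then show ?thesis using True by simp
next
  case False
  define \<gamma> where "\<gamma> t = v + t *\<^sub>R h" for t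
  have \<gamma>: "\<gamma> t \<in> X" if "t \<in> {0..1}" for t
  proof -
    have "\<gamma> t = (1 - t) *\<^sub>R v + t *\<^sub>R x" by (simp add: \<gamma>_def h_def algebra_simps)
    then show ?thesis using convexD[OF X(2) vx, of "1 - t" t] that by simp
  qed
  have hRd: "h \<in> Rd d"
    unfolding h_def using X vx by (intro subspace_diff[OF subspace_Rd]) auto
  define A where "A y hs = D i y hs - D i (\<gamma> t) hs - D (Suc i) (\<gamma> t) ((y - \<gamma> t) # hs)" for y hs
  have ml: "multilinear d i (D i y)" "multilinear d (Suc i) (D (Suc i) y)" if "y \<in> X" for y
    using D i that by (auto simp: derivatives_def)
  have mlA: "multilinear d i (A y)" if "y \<in> X" for y
    unfolding A_def using that \<gamma>[OF t] X
    by (intro multilinear_diff multilinear_Cons ml subspace_diff[OF subspace_Rd]) auto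
  have "((\<lambda>y. op_norm d i (A y) / norm (y - \<gamma> t)) \<longlongrightarrow> 0) (at (\<gamma> t) within X)"
    using D i \<gamma>[OF t] unfolding derivatives_def A_def by blast
  moreover have "filterlim \<gamma> (at (\<gamma> t) within X) (at t within {0..1})"
    unfolding filterlim_at
  proof
    have "continuous (at t within {0..1}) \<gamma>"
      unfolding \<gamma>_def by (intro continuous_intros)
    then show "(\<gamma> \<longlongrightarrow> \<gamma> t) (at t within {0..1})"
      by (simp add: continuous_within)
    show "\<forall>\<^sub>F u in at t within {0..1}. \<gamma> u \<in> X \<and> \<gamma> u \<noteq> \<gamma> t"
      unfolding eventually_at_filter using \<gamma> False by (auto simp: \<gamma>_def)
  qed
  ultimately have "((\<lambda>u. op_norm d i (A (\<gamma> u)) / norm (\<gamma> u - \<gamma> t)) \<longlongrightarrow> 0) (at t within {0..1})"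
    by (rule filterlim_compose)
  then have lim: "((\<lambda>u. op_norm d i (A (\<gamma> u)) / norm (\<gamma> u - \<gamma> t) * norm h ^ Suc i) \<longlongrightarrow> 0)
      (at t within {0..1})"
    by (rule tendsto_mult_left_zero)
  have bound: "norm (D i (\<gamma> u) (replicate i h) - D i (\<gamma> t) (replicate i h)
        - (u - t) *\<^sub>R D (Suc i) (\<gamma> t) (replicate (Suc i) h)) / norm (u - t)
      \<le> op_norm d i (A (\<gamma> u)) / norm (\<gamma> u - \<gamma> t) * norm h ^ Suc i"
    if "u \<in> {0..1}" "u \<noteq> t" for u
  proof -
    have diff: "\<gamma> u - \<gamma> t = (u - t) *\<^sub>R h" by (simp add: \<gamma>_def algebra_simps)
    have "D (Suc i) (\<gamma> t) ((\<gamma> u - \<gamma> t) # replicate i h)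
        = (u - t) *\<^sub>R D (Suc i) (\<gamma> t) (h # replicate i h)"
      using multilinear_head[OF ml(2)[OF \<gamma>[OF t]], of "replicate i h" h h "u - t" 0] hRd
      by (simp add: diff set_replicate_conv_if)
    then have "norm (D i (\<gamma> u) (replicate i h) - D i (\<gamma> t) (replicate i h)
        - (u - t) *\<^sub>R D (Suc i) (\<gamma> t) (replicate (Suc i) h)) = norm (A (\<gamma> u) (replicate i h))"
      by (simp add: A_def)
    also have "\<dots> \<le> op_norm d i (A (\<gamma> u)) * norm h ^ i"
      by (rule norm_diagonal_le[OF mlA[OF \<gamma>[OF that(1)]] hRd])
    finally have le: "norm (D i (\<gamma> u) (replicate i h) - D i (\<gamma> t) (replicate i h)
        - (u - t) *\<^sub>R D (Suc i) (\<gamma> t) (replicate (Suc i) h)) \<le> op_norm d i (A (\<gamma> u)) * norm h ^ i" .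
    have "op_norm d i (A (\<gamma> u)) / norm (\<gamma> u - \<gamma> t) * norm h ^ Suc i
        = op_norm d i (A (\<gamma> u)) * norm h ^ i / norm (u - t)"
      unfolding diff norm_scaleR power_Suc using False by simp
    then show ?thesis
      using divide_right_mono[OF le, of "norm (u - t)"] by (simp only: norm_ge_zero)
  qed
  have "((\<lambda>u. D i (\<gamma> u) (replicate i h)) has_vector_derivative
      D (Suc i) (\<gamma> t) (replicate (Suc i) h)) (at t within {0..1})"
    unfolding has_vector_derivative_def has_derivative_iff_norm
  proof
    show "((\<lambda>u. norm (D i (\<gamma> u) (replicate i h) - D i (\<gamma> t) (replicate i h)
        - (u - t) *\<^sub>R D (Suc i) (\<gamma> t) (replicate (Suc i) h)) / norm (u - t)) \<longlongrightarrow> 0) (at t within {0..1})"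
      by (rule tendsto_sandwich[OF _ _ tendsto_const lim])
        (use bound in \<open>auto simp: eventually_at_filter\<close>)
  qed (rule bounded_linear_scaleR_left)
  then show ?thesis by (simp add: \<gamma>_def)
qed

lemma taylor_model_error:
  assumes D: "derivatives d X m F D" and X: "X \<subseteq> Rd d" "convex X"
    and lip: "\<And>y z. y \<in> X \<Longrightarrow> z \<in> X \<Longrightarrow>
      op_norm d m (\<lambda>hs. D m y hs - D m z hs) \<le> L * norm (y - z)"
    and vx: "v \<in> X" "x \<in> X"
  shows "norm (F x - (\<Sum>i\<le>m. (1 / fact i) *\<^sub>R D i v (replicate i (x - v))))
    \<le> L / fact (Suc m) * norm (x - v) ^ Suc m"
proof -
  define h where "h = x - v"
  define f where "f i t = D i (v + t *\<^sub>R h) (replicate i h)" for i t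
  have hRd: "h \<in> Rd d"
    unfolding h_def using X vx by (intro subspace_diff[OF subspace_Rd]) auto
  have top: "norm (f m t - f m 0) \<le> L * norm h ^ Suc m * t" if t: "t \<in> {0..1}" for t
  proof -
    have "v + t *\<^sub>R h = (1 - t) *\<^sub>R v + t *\<^sub>R x" by (simp add: h_def algebra_simps)
    then have y: "v + t *\<^sub>R h \<in> X" using convexD[OF X(2) vx, of "1 - t" t] t by simp
    have ml: "multilinear d m (\<lambda>hs. D m (v + t *\<^sub>R h) hs - D m v hs)"
      using D y vx by (intro multilinear_diff) (auto simp: derivatives_def)
    have "norm (f m t - f m 0)
        \<le> op_norm d m (\<lambda>hs. D m (v + t *\<^sub>R h) hs - D m v hs) * norm h ^ m"
      using norm_diagonal_le[OF ml hRd] by (simp add: f_def)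
    also have "\<dots> \<le> L * norm (v + t *\<^sub>R h - v) * norm h ^ m"
      by (intro mult_right_mono lip y vx) auto
    finally show ?thesis using t by (simp add: mult_ac)
  qed
  have "norm (f 0 1 - (\<Sum>i\<le>m. (1 ^ i / fact i) *\<^sub>R f i 0))
      \<le> L * norm h ^ Suc m * 1 ^ Suc m / fact (Suc m)"
  proof (rule taylor_remainder_le)
    show "(f i has_vector_derivative f (Suc i) t) (at t within {0..1})"
      if "i < m" "t \<in> {0..1}" for i t
      using derivative_along_segment[OF D X vx that] unfolding f_def[abs_def] h_def .
  qed (use top in auto)
  moreover have "f 0 1 = F x"
    using D vx by (simp add: f_def h_def derivatives_def)
  ultimately show ?thesis by (simp add: f_def h_def)
qed

text \<open>
  The error hypothesis on \<open>G i\<close> leaves the last argument free; inserting \<open>x - v\<close> there as well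
  bounds the error of the \<open>i\<close>-th term of the model.
\<close>

lemma inexact_model_error:
  assumes p: "p \<ge> 1" and D: "derivatives d X (p - 1) F D" and X: "X \<subseteq> Rd d" "convex X"
    and lip: "\<And>y z. y \<in> X \<Longrightarrow> z \<in> X \<Longrightarrow>
      op_norm d (p - 1) (\<lambda>hs. D (p - 1) y hs - D (p - 1) z hs) \<le> L * norm (y - z)"
    and G: "\<And>i u. i \<in> {1..p-1} \<Longrightarrow> u \<in> X \<Longrightarrow> multilinear d i (G i u)"
    and inexact: "\<And>i y u. i \<in> {1..p-1} \<Longrightarrow> y \<in> X \<Longrightarrow> u \<in> X \<Longrightarrow>
      op_norm d 1 (\<lambda>hs. D i u (replicate (i - 1) (y - u) @ hs) - G i u (replicate (i - 1) (y - u) @ hs))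
        \<le> \<delta> i * norm (y - u) ^ (i - 1)"
    and vx: "v \<in> X" "x \<in> X"
  shows "norm (F x - Psi F G p v x)
    \<le> (L / fact p * norm (x - v) ^ (p - 1) + (\<Sum>i=1..p-1. \<delta> i / fact i * norm (x - v) ^ (i - 1)))
        * norm (x - v)"
proof -
  define h where "h = x - v"
  have hRd: "h \<in> Rd d"
    unfolding h_def using X vx by (intro subspace_diff[OF subspace_Rd]) auto
  define E where "E i = D i v (replicate i h) - G i v (replicate i h)" for i
  have term_le: "norm (E i) \<le> \<delta> i * norm h ^ (i - 1) * norm h" if i: "i \<in> {1..p-1}" for i
  proof -
    define A where "A hs = D i v (replicate (i - 1) h @ hs) - G i v (replicate (i - 1) h @ hs)" for hs
    have "multilinear d (i - 1 + 1) (D i v)" "multilinear d (i - 1 + 1) (G i v)"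
      using D G i vx by (auto simp: derivatives_def)
    then have ml: "multilinear d 1 A"
      unfolding A_def using hRd by (intro multilinear_diff multilinear_append[where n = "i - 1"]) auto
    have "replicate i h = replicate (i - 1) h @ [h]"
      using i by (cases i) (auto simp: replicate_append_same)
    then have "norm (E i) = norm (A (replicate 1 h))"
      by (simp add: E_def A_def)
    also have "\<dots> \<le> op_norm d 1 A * norm h"
      using norm_diagonal_le[OF ml hRd] by simp
    also have "op_norm d 1 A \<le> \<delta> i * norm h ^ (i - 1)"
      unfolding A_def h_def by (rule inexact[OF i vx(2,1)])
    finally show ?thesis by (simp add: mult_right_mono)
  qed
  have split: "(\<Sum>i\<le>p-1. g i) = g 0 + (\<Sum>i=1..p-1. g i)" for g :: "nat \<Rightarrow> rvec"
    by (simp add: sum.atMost_shift atMost_atLeast0 sum.atLeast_Suc_atMost)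
  have D0: "D 0 v [] = F v"
    using D vx by (auto simp: derivatives_def)
  have "F x - Psi F G p v x = (F x - (\<Sum>i\<le>p-1. (1 / fact i) *\<^sub>R D i v (replicate i h)))
      + (\<Sum>i=1..p-1. (1 / fact i) *\<^sub>R E i)"
    unfolding Psi_def split E_def scaleR_diff_right sum_subtractf by (simp add: D0 h_def)
  also have "norm \<dots> \<le> L / fact (Suc (p - 1)) * norm h ^ Suc (p - 1)
      + (\<Sum>i=1..p-1. 1 / fact i * (\<delta> i * norm h ^ (i - 1) * norm h))"
  proof (rule norm_triangle_mono)
    show "norm (F x - (\<Sum>i\<le>p-1. (1 / fact i) *\<^sub>R D i v (replicate i h)))
        \<le> L / fact (Suc (p - 1)) * norm h ^ Suc (p - 1)"
      unfolding h_def by (rule taylor_model_error[OF D X lip vx])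
    show "norm (\<Sum>i=1..p-1. (1 / fact i) *\<^sub>R E i)
        \<le> (\<Sum>i=1..p-1. 1 / fact i * (\<delta> i * norm h ^ (i - 1) * norm h))"
      using term_le by (intro sum_norm_le) (simp add: divide_right_mono)
  qed
  also have "\<dots> = (L / fact p * norm h ^ (p - 1)
      + (\<Sum>i=1..p-1. \<delta> i / fact i * norm h ^ (i - 1))) * norm h"
  proof -
    have "Suc (p - 1) = p" using p by simp
    moreover have "norm h ^ p = norm h ^ (p - 1) * norm h"
      using p by (cases p) auto
    ultimately show ?thesis by (simp add: distrib_right sum_distrib_right)
  qed
  finally show ?thesis by (simp add: h_def)
qed

section \<open>Dual extrapolation\<close>

text \<open>
  A maximiser of \<open>s \<bullet> (u - x0) - norm (u - x0)\<^sup>2 / 2\<close> is a point of \<open>X\<close> closest to \<open>x0 + s\<close>,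
  so the obtuse-angle property of projections gives the quadratic growth of the objective away
  from its maximiser.
\<close>

lemma regularized_max_quadratic_growth:
  fixes s x0 :: "'a::real_inner"
  assumes X: "convex X" "closed X"
    and v: "is_arg_max (\<lambda>u. s \<bullet> (u - x0) - 1/2 * norm (u - x0) ^ 2) (\<lambda>u. u \<in> X) v"
    and w: "w \<in> X"
  shows "s \<bullet> (w - x0) - norm (w - x0) ^ 2 / 2 + norm (w - v) ^ 2 / 2
    \<le> s \<bullet> (v - x0) - norm (v - x0) ^ 2 / 2"
proof -
  have complete_square: "norm (x0 + s - u) ^ 2
      = norm s ^ 2 - 2 * (s \<bullet> (u - x0) - 1/2 * norm (u - x0) ^ 2)" for u
    by (simp add: power2_norm_eq_inner algebra_simps inner_commute)
  have vX: "v \<in> X" and max: "s \<bullet> (u - x0) - 1/2 * norm (u - x0) ^ 2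
      \<le> s \<bullet> (v - x0) - 1/2 * norm (v - x0) ^ 2" if "u \<in> X" for u
    using v that by (auto simp: is_arg_max_def not_less)
  have "dist (x0 + s) v \<le> dist (x0 + s) u" if "u \<in> X" for u
  proof (rule power2_le_imp_le)
    show "(dist (x0 + s) v)\<^sup>2 \<le> (dist (x0 + s) u)\<^sup>2"
      unfolding dist_norm complete_square using max[OF that] by simp
  qed simp
  then have "(x0 + s - v) \<bullet> (w - v) \<le> 0"
    by (intro any_closest_point_dot[OF X vX[OF w] w]) auto
  moreover have "(x0 + s - v) \<bullet> (w - v) = s \<bullet> (w - x0) - s \<bullet> (v - x0) - (w - v) \<bullet> (v - x0)"
    by (simp add: algebra_simps inner_commute)
  moreover have "norm (w - x0) ^ 2 = norm (w - v) ^ 2 + norm (v - x0) ^ 2 + 2 * ((w - v) \<bullet> (v - x0))"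
    by (simp add: power2_norm_eq_inner algebra_simps inner_commute)
  ultimately show ?thesis by linarith
qed

text \<open>
  The gain \<open>norm (w - v)\<^sup>2 / 2\<close> from quadratic growth pays exactly for the regret of the next
  step, so the regrets telescope.
\<close>

lemma dual_extrapolation_regret:
  fixes g x v s :: "nat \<Rightarrow> 'a::real_inner" and c :: "nat \<Rightarrow> real"
  assumes X: "convex X" "closed X" and s0: "s 0 = 0"
    and v: "\<And>k. k < T \<Longrightarrow>
      is_arg_max (\<lambda>u. s k \<bullet> (u - x0) - 1/2 * norm (u - x0) ^ 2) (\<lambda>u. u \<in> X) (v (Suc k))"
    and s: "\<And>k. k < T \<Longrightarrow> s (Suc k) = s k - g (Suc k)"
    and step: "\<And>k w. k < T \<Longrightarrow> w \<in> X \<Longrightarrow>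
      g (Suc k) \<bullet> (x (Suc k) - w) + c (Suc k) \<le> norm (w - v (Suc k)) ^ 2 / 2"
    and w: "w \<in> X"
  shows "(\<Sum>k=1..T. g k \<bullet> (x k - w) + c k) \<le> norm (w - x0) ^ 2 / 2"
proof -
  have s_eq: "s n = - (\<Sum>k=1..n. g k)" if "n \<le> T" for n
    using that by (induction n) (auto simp: s0 s)
  have "(\<Sum>k=1..n. g k \<bullet> (x k - w) + c k) \<le> norm (w - x0) ^ 2 / 2" if "n \<le> T" "w \<in> X" for n w
    using that
  proof (induction n arbitrary: w)
    case (Suc n)
    then have n: "n < T" by simp
    let ?v = "v (Suc n)"
    have vX: "?v \<in> X" using v[OF n] by (simp add: is_arg_max_def)
    have "(\<Sum>k=1..n. g k \<bullet> (x k - w) + c k)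
        = (\<Sum>k=1..n. g k \<bullet> (x k - ?v) + c k) + (\<Sum>k=1..n. g k \<bullet> (?v - w))"
      unfolding sum.distrib[symmetric] by (rule sum.cong) (auto simp: inner_diff_right)
    also have "(\<Sum>k=1..n. g k \<bullet> (?v - w)) = - (s n \<bullet> (?v - w))"
      using s_eq[of n] n by (simp add: inner_sum_left)
    also have "(\<Sum>k=1..n. g k \<bullet> (x k - ?v) + c k) \<le> norm (?v - x0) ^ 2 / 2"
      using Suc.IH[OF _ vX] n by simp
    finally have "(\<Sum>k=1..n. g k \<bullet> (x k - w) + c k)
        \<le> norm (?v - x0) ^ 2 / 2 - s n \<bullet> (?v - w)"
      by simp
    moreover have "s n \<bullet> (?v - w) = s n \<bullet> (?v - x0) - s n \<bullet> (w - x0)"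
      by (simp add: inner_diff_right)
    moreover note regularized_max_quadratic_growth[OF X v[OF n] Suc.prems(2)]
      step[OF n Suc.prems(2)]
    moreover have "(\<Sum>k=1..Suc n. g k \<bullet> (x k - w) + c k)
        = (\<Sum>k=1..n. g k \<bullet> (x k - w) + c k) + (g (Suc n) \<bullet> (x (Suc n) - w) + c (Suc n))"
      by simp
    ultimately show ?case by linarith
  qed simp
  then show ?thesis using w by blast
qed

text \<open>
  Here \<open>\<theta>\<close> is the common factor of the model error, of the accuracy of the subproblem
  and of the regularisation; only the last one carries the factor \<open>5 q\<close>.  With \<open>r = norm (x - v)\<close>
  and \<open>a = norm (w - v)\<close> the three contribute at most
  \<open>\<lambda> \<theta> ((5 q + 1) r a - (5 q - 2) r\<^sup>2)\<close>, and the window for \<open>\<lambda> \<theta>\<close> turns this into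
  \<open>r a / 2 - r\<^sup>2 / 4 \<le> a\<^sup>2 / 2 - r\<^sup>2 / 8\<close>.
\<close>

lemma regularized_step_progress:
  fixes x v w f \<Psi> :: "'a::real_inner" and q :: real
  assumes model: "norm (f - \<Psi>) \<le> \<theta> * norm (x - v)"
    and sub: "(\<Psi> + (5 * q * \<theta>) *\<^sub>R (x - v)) \<bullet> (x - w) \<le> \<theta> * norm (x - v) ^ 2"
    and lower: "1 / (4 * (5 * q - 2)) \<le> l * \<theta>" and upper: "l * \<theta> \<le> 1 / (2 * (5 * q + 1))"
    and q: "q \<ge> 1" and \<theta>: "\<theta> \<ge> 0" and l: "l \<ge> 0"
  shows "(l *\<^sub>R f) \<bullet> (x - w) + norm (x - v) ^ 2 / 8 \<le> norm (w - v) ^ 2 / 2"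
proof -
  define r a where "r = norm (x - v)" and "a = norm (w - v)"
  have ra: "r \<ge> 0" "a \<ge> 0" by (auto simp: r_def a_def)
  have "norm (x - w) \<le> r + a"
    using norm_triangle_ineq4[of "x - v" "w - v"] by (simp add: r_def a_def)
  then have "(f - \<Psi>) \<bullet> (x - w) \<le> \<theta> * r * (r + a)"
    using norm_cauchy_schwarz[of "f - \<Psi>" "x - w"] mult_mono[OF model, of "norm (x - w)" "r + a"]
      \<theta> ra by (simp add: r_def)
  moreover have "(x - v) \<bullet> (x - w) \<ge> r ^ 2 - r * a"
  proof -
    have "(x - v) \<bullet> (x - w) = r ^ 2 - (x - v) \<bullet> (w - v)"
      by (simp add: r_def power2_norm_eq_inner inner_diff_right)
    then show ?thesis
      using norm_cauchy_schwarz[of "x - v" "w - v"] by (simp add: r_def a_def)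
  qed
  then have "(5 * q * \<theta>) * ((x - v) \<bullet> (x - w)) \<ge> (5 * q * \<theta>) * (r ^ 2 - r * a)"
    using q \<theta> by (intro mult_left_mono) auto
  moreover have "f \<bullet> (x - w) = (f - \<Psi>) \<bullet> (x - w)
      + (\<Psi> + (5 * q * \<theta>) *\<^sub>R (x - v)) \<bullet> (x - w) - (5 * q * \<theta>) * ((x - v) \<bullet> (x - w))"
    by (simp add: inner_diff_left inner_add_left)
  ultimately have "f \<bullet> (x - w)
      \<le> \<theta> * r * (r + a) + \<theta> * r ^ 2 - (5 * q * \<theta>) * (r ^ 2 - r * a)"
    using sub unfolding r_def by linarith
  also have "\<dots> = \<theta> * ((5 * q + 1) * (r * a) - (5 * q - 2) * r ^ 2)"
    by (simp add: algebra_simps power2_eq_square)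
  finally have "l * (f \<bullet> (x - w))
      \<le> l * (\<theta> * ((5 * q + 1) * (r * a) - (5 * q - 2) * r ^ 2))"
    using l by (intro mult_left_mono) auto
  also have "\<dots> = (l * \<theta> * (5 * q + 1)) * (r * a) - (l * \<theta> * (5 * q - 2)) * r ^ 2"
    by (simp add: algebra_simps)
  also have "\<dots> \<le> 1/2 * (r * a) - 1/4 * r ^ 2"
  proof (intro diff_mono mult_right_mono)
    show "l * \<theta> * (5 * q + 1) \<le> 1/2" using upper q by (simp add: field_simps)
    show "1/4 \<le> l * \<theta> * (5 * q - 2)" using lower q by (simp add: field_simps)
  qed (use ra in auto)
  also have "\<dots> = a ^ 2 / 2 - r ^ 2 / 8 - (a - r / 2) ^ 2 / 2"
    by (simp add: power2_eq_square field_simps)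
  also have "\<dots> \<le> a ^ 2 / 2 - r ^ 2 / 8"
    by simp
  finally show ?thesis
    unfolding r_def a_def by simp
qed

section \<open>From the regret bound to the rate\<close>

text \<open>
  A step shorter than \<open>3 D / sqrt T\<close> has weight at least \<open>c / \<theta> (3 D / sqrt T)\<close>, and the budget
  for the squared lengths leaves at least half of the steps short, since
  \<open>4 D\<^sup>2 / (3 D / sqrt T)\<^sup>2 = 4 T / 9\<close>.  The factor
  \<open>1 - (r / R)\<^sup>2\<close>, which is negative for long steps, expresses this without counting.
\<close>

lemma sum_stepsizes_lower_bound:
  fixes r l :: "nat \<Rightarrow> real" and \<theta> :: "real \<Rightarrow> real"
  assumes budget: "(\<Sum>k=1..T. (r k)\<^sup>2) \<le> 4 * D\<^sup>2" and D: "D > 0" and T: "T \<ge> 1"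
    and step: "\<And>k. k \<in> {1..T} \<Longrightarrow> c \<le> l k * \<theta> (r k)"
    and nonneg: "\<And>k. k \<in> {1..T} \<Longrightarrow> l k \<ge> 0" "\<And>k. k \<in> {1..T} \<Longrightarrow> r k \<ge> 0"
    and mono: "\<And>a b. 0 \<le> a \<Longrightarrow> a \<le> b \<Longrightarrow> \<theta> a \<le> \<theta> b" and \<theta>0: "\<theta> 0 \<ge> 0" and c: "c \<ge> 0"
  shows "c * T / 2 \<le> (\<Sum>k=1..T. l k) * \<theta> (3 * D / sqrt T)"
proof -
  define R where "R = 3 * D / sqrt T"
  have R: "R > 0" using D T by (simp add: R_def)
  have R2: "R\<^sup>2 = 9 * D\<^sup>2 / T" using T by (simp add: R_def power_divide power_mult_distrib)
  have "c * (1 - (r k)\<^sup>2 / R\<^sup>2) \<le> l k * \<theta> R" if k: "k \<in> {1..T}" for k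
  proof (cases "r k \<le> R")
    case True
    have "c * (1 - (r k)\<^sup>2 / R\<^sup>2) \<le> c"
      using c by (simp add: mult_left_le)
    also have "c \<le> l k * \<theta> (r k)" by (rule step[OF k])
    also have "\<dots> \<le> l k * \<theta> R" using True mono nonneg k by (intro mult_left_mono) auto
    finally show ?thesis .
  next
    case False
    then have "R\<^sup>2 \<le> (r k)\<^sup>2" using R by (intro power_mono) auto
    then have "c * (1 - (r k)\<^sup>2 / R\<^sup>2) \<le> 0"
      using R c by (intro mult_nonneg_nonpos) (auto simp: field_simps)
    also have "0 \<le> l k * \<theta> R"
      using mono[of 0 R] R \<theta>0 nonneg k by simp
    finally show ?thesis .
  qed
  then have "(\<Sum>k=1..T. c * (1 - (r k)\<^sup>2 / R\<^sup>2)) \<le> (\<Sum>k=1..T. l k * \<theta> R)"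
    by (rule sum_mono)
  moreover have "(\<Sum>k=1..T. c * (1 - (r k)\<^sup>2 / R\<^sup>2)) = c * (T - (\<Sum>k=1..T. (r k)\<^sup>2) / R\<^sup>2)"
    by (simp add: sum_subtractf flip: sum_distrib_left sum_divide_distrib)
  moreover have "(\<Sum>k=1..T. (r k)\<^sup>2) / R\<^sup>2 \<le> T / 2"
  proof -
    have "T / 2 * R\<^sup>2 = 9 / 2 * D\<^sup>2"
      using T by (simp add: R2)
    then have "(\<Sum>k=1..T. (r k)\<^sup>2) \<le> T / 2 * R\<^sup>2"
      using budget zero_le_power2[of D] by linarith
    then show ?thesis using R by (simp add: divide_le_eq)
  qed
  then have "c * (T - (\<Sum>k=1..T. (r k)\<^sup>2) / R\<^sup>2) \<ge> c * (T / 2)"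
    using c by (intro mult_left_mono) auto
  ultimately have "c * T / 2 \<le> (\<Sum>k=1..T. l k * \<theta> R)" by linarith
  then show ?thesis
    by (simp only: R_def sum_distrib_right)
qed

lemma powr_half_nat_add_1: "real T powr ((real n + 1) / 2) = sqrt T ^ (n + 1)"
proof (cases "T = 0")
  case False
  then have "real T powr ((real n + 1) / 2) = sqrt (real T powr real (n + 1))"
    by (simp add: powr_half_sqrt_powr add.commute)
  also have "\<dots> = sqrt T ^ (n + 1)"
    using False by (simp only: powr_realpow real_sqrt_power of_nat_0_less_iff)
  finally show ?thesis .
qed simp

lemma rate_term:
  fixes D :: real
  assumes a: "a \<ge> 0" and D: "D \<ge> 0" and j: "1 \<le> j" "j \<le> p" and T: "T \<ge> 1"
  shows "D\<^sup>2 / T * (a / fact j * (3 * D / sqrt T) ^ (j - 1))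
    \<le> 3 ^ p * (a * D ^ (j + 1) / real T powr ((real j + 1) / 2))"
proof -
  have j': "j + 1 = (j - 1) + 2" using j by simp
  have "D\<^sup>2 / T * (a / fact j * (3 * D / sqrt T) ^ (j - 1))
      = 3 ^ (j - 1) / fact j * (a * D ^ (j + 1) / sqrt T ^ (j + 1))"
    unfolding j' power_add using T by (simp add: power_mult_distrib power_divide mult_ac)
  also have "\<dots> \<le> 3 ^ p * (a * D ^ (j + 1) / sqrt T ^ (j + 1))"
  proof (rule mult_right_mono)
    have "3 ^ (j - 1) / fact j \<le> (3 ^ (j - 1) :: real)"
      using divide_left_mono[of 1 "fact j :: real" "3 ^ (j - 1)"] by (simp add: fact_ge_1)
    also have "\<dots> \<le> 3 ^ p" using j by (intro power_increasing) auto
    finally show "3 ^ (j - 1) / fact j \<le> (3 ^ p :: real)" .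
  qed (use a D in auto)
  finally show ?thesis unfolding powr_half_nat_add_1 .
qed

text \<open>
  Monotonicity replaces \<open>F (x k)\<close> by \<open>F w\<close> in the regret, which makes it affine in \<open>x k\<close>, so that
  the weighted sum becomes a value at the average.  The bound for \<open>\<Sum>k. c k\<close> is the case where \<open>w\<close>
  is the average.
\<close>

lemma weighted_average_gap:
  fixes F :: "'a::real_inner \<Rightarrow> 'a" and x :: "nat \<Rightarrow> 'a"
  assumes X: "convex X" and x: "\<And>k. k \<in> {1..T} \<Longrightarrow> x k \<in> X"
    and mono: "\<And>y z. y \<in> X \<Longrightarrow> z \<in> X \<Longrightarrow> (F y - F z) \<bullet> (y - z) \<ge> 0"
    and l: "\<And>k. k \<in> {1..T} \<Longrightarrow> l k > 0" and T: "T \<ge> 1"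
    and regret: "\<And>w. w \<in> X \<Longrightarrow> (\<Sum>k=1..T. (l k *\<^sub>R F (x k)) \<bullet> (x k - w) + c k) \<le> B"
  defines "\<Lambda> \<equiv> \<Sum>k=1..T. l k"
  defines "xbar \<equiv> (1 / \<Lambda>) *\<^sub>R (\<Sum>k=1..T. l k *\<^sub>R x k)"
  shows "xbar \<in> X" and "(\<Sum>k=1..T. c k) \<le> B"
    and "w \<in> X \<Longrightarrow> \<Lambda> * (F w \<bullet> (xbar - w)) + (\<Sum>k=1..T. c k) \<le> B"
proof -
  have \<Lambda>: "\<Lambda> > 0"
    unfolding \<Lambda>_def using l T by (intro sum_pos) auto
  have "(\<Sum>k=1..T. (l k / \<Lambda>) *\<^sub>R x k) \<in> X"
  proof (rule convex_sum)
    show "(\<Sum>k=1..T. l k / \<Lambda>) = 1"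
      using \<Lambda> by (simp add: \<Lambda>_def flip: sum_divide_distrib)
  qed (use X x l \<Lambda> in \<open>auto simp: less_imp_le\<close>)
  then show xbar: "xbar \<in> X"
    by (simp add: xbar_def scaleR_sum_right divide_inverse mult.commute)
  have gap: "\<Lambda> * (F w \<bullet> (xbar - w)) + (\<Sum>k=1..T. c k) \<le> B" if w: "w \<in> X" for w
  proof -
    have "\<Lambda> *\<^sub>R (xbar - w) = (\<Sum>k=1..T. l k *\<^sub>R (x k - w))"
      using \<Lambda> by (simp add: xbar_def scaleR_diff_right sum_subtractf \<Lambda>_def flip: scaleR_sum_left)
    then have "\<Lambda> * (F w \<bullet> (xbar - w)) = F w \<bullet> (\<Sum>k=1..T. l k *\<^sub>R (x k - w))"
      by (metis inner_scaleR_right)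
    also have "\<dots> = (\<Sum>k=1..T. l k * (F w \<bullet> (x k - w)))"
      by (simp add: inner_sum_right)
    also have "\<dots> \<le> (\<Sum>k=1..T. (l k *\<^sub>R F (x k)) \<bullet> (x k - w))"
    proof (rule sum_mono)
      fix k assume k: "k \<in> {1..T}"
      have "F w \<bullet> (x k - w) \<le> F (x k) \<bullet> (x k - w)"
        using mono[OF x[OF k] w] by (simp add: inner_diff_left)
      then show "l k * (F w \<bullet> (x k - w)) \<le> (l k *\<^sub>R F (x k)) \<bullet> (x k - w)"
        using l[OF k] by simp
    qed
    finally show ?thesis
      using regret[OF w] by (simp add: sum.distrib)
  qed
  show "w \<in> X \<Longrightarrow> \<Lambda> * (F w \<bullet> (xbar - w)) + (\<Sum>k=1..T. c k) \<le> B" by (rule gap)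
  show "(\<Sum>k=1..T. c k) \<le> B" using gap[OF xbar] by simp
qed

section \<open>The convergence rate\<close>

definition step_scale :: "real \<Rightarrow> (nat \<Rightarrow> real) \<Rightarrow> nat \<Rightarrow> real \<Rightarrow> real"
  where "step_scale L \<delta> p r = L / fact p * r ^ (p - 1) + (\<Sum>i=1..p-1. \<delta> i / fact i * r ^ (i - 1))"

lemma step_scale_mono:
  assumes "L \<ge> 0" "\<And>i. i \<in> {1..p-1} \<Longrightarrow> \<delta> i \<ge> 0" "0 \<le> a" "a \<le> b"
  shows "step_scale L \<delta> p a \<le> step_scale L \<delta> p b"
  unfolding step_scale_def using assms
  by (intro add_mono sum_mono mult_left_mono power_mono) auto

lemma step_scale_nonneg:
  assumes "L \<ge> 0" "\<And>i. i \<in> {1..p-1} \<Longrightarrow> \<delta> i \<ge> 0" "0 \<le> r"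
  shows "0 \<le> step_scale L \<delta> p r"
  unfolding step_scale_def using assms by (intro add_nonneg_nonneg sum_nonneg) auto

text \<open>The weights of \<open>Omega\<close> with \<open>\<eta> i = 5 p\<close> collect to \<open>5 p\<close> times the step scale, because
  \<open>5 * L / fact (p - 1) = 5 * p * (L / fact p)\<close>.\<close>

lemma Omega_eq_step_scale:
  assumes "p \<ge> 1"
  shows "Omega F G L \<delta> (\<lambda>i. 5 * real p) p v x
    = Psi F G p v x + (5 * real p * step_scale L \<delta> p (norm (x - v))) *\<^sub>R (x - v)"
proof -
  have "fact p = real p * fact (p - 1)"
    using assms by (simp add: fact_reduce)
  then have "5 * L / fact (p - 1) = 5 * real p * (L / fact p)"
    using assms by simp
  then show ?thesis
    by (simp add: Omega_def step_scale_def scaleR_add_left distrib_left sum_distrib_left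
        scaleR_sum_left mult.assoc)
qed

lemma step_scale_times_square:
  assumes "p \<ge> 1"
  shows "step_scale L \<delta> p r * r\<^sup>2
    = L / fact p * r ^ (p + 1) + (\<Sum>i=1..p-1. \<delta> i / fact i * r ^ (i + 1))"
proof -
  have pow: "r ^ (j + 1) = r ^ (j - 1) * r\<^sup>2" if "1 \<le> j" for j
  proof -
    have "j + 1 = (j - 1) + 2" using that by simp
    then show ?thesis by (simp only: power_add)
  qed
  have "(\<Sum>i=1..p-1. \<delta> i / fact i * r ^ (i + 1)) = (\<Sum>i=1..p-1. \<delta> i / fact i * r ^ (i - 1) * r\<^sup>2)"
    by (rule sum.cong) (use pow in \<open>simp_all only: atLeastAtMost_iff mult.assoc\<close>)
  then show ?thesis
    unfolding pow[OF assms] by (simp add: step_scale_def distrib_right sum_distrib_right mult.assoc)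
qed

lemma bdd_above_inner_diff:
  fixes a b :: "'a::real_inner"
  assumes "bounded X"
  shows "bdd_above ((\<lambda>y. a \<bullet> (b - y)) ` X)"
proof -
  obtain B where B: "\<And>y. y \<in> X \<Longrightarrow> norm y \<le> B"
    using assms by (auto simp: bounded_iff)
  have "a \<bullet> (b - y) \<le> norm a * (norm b + B)" if "y \<in> X" for y
  proof -
    have "a \<bullet> (b - y) \<le> norm a * norm (b - y)" by (rule norm_cauchy_schwarz)
    also have "\<dots> \<le> norm a * (norm b + B)"
      using norm_triangle_ineq4[of b y] B[OF that] by (intro mult_left_mono) auto
    finally show ?thesis .
  qed
  then show ?thesis by (rule bdd_aboveI2)
qed

text \<open>
  The regret bound enters twice: at the averaged output, where it limits the step lengths and so
  forces the total weight to be large, and at \<open>w\<close>, where it limits the weighted gap.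
\<close>

lemma VIHI_gap_bound:
  fixes p :: nat
  assumes p: "p \<ge> 2" and X: "X \<subseteq> Rd d" "closed X" "bounded X" "convex X"
    and mono: "\<And>y z. y \<in> X \<Longrightarrow> z \<in> X \<Longrightarrow> (F y - F z) \<bullet> (y - z) \<ge> 0"
    and D: "derivatives d X (p - 1) F D"
    and lip: "\<And>y z. y \<in> X \<Longrightarrow> z \<in> X \<Longrightarrow>
      op_norm d (p - 1) (\<lambda>hs. D (p - 1) y hs - D (p - 1) z hs) \<le> L * norm (y - z)"
    and \<delta>: "\<And>i. i \<in> {1..p-1} \<Longrightarrow> \<delta> i \<ge> 0"
    and G: "\<And>i u. i \<in> {1..p-1} \<Longrightarrow> u \<in> X \<Longrightarrow> multilinear d i (G i u)"
    and inexact: "\<And>i y u. i \<in> {1..p-1} \<Longrightarrow> y \<in> X \<Longrightarrow> u \<in> X \<Longrightarrow>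
      op_norm d 1 (\<lambda>hs. D i u (replicate (i - 1) (y - u) @ hs) - G i u (replicate (i - 1) (y - u) @ hs))
        \<le> \<delta> i * norm (y - u) ^ (i - 1)"
    and T: "T \<ge> 1"
    and run: "VIHI X F G L \<delta> (\<lambda>i. 5 * real p) p T x v s lam"
    and w: "w \<in> X"
  shows "F w \<bullet> (averaged_output T x lam - w)
    \<le> 4 * (5 * real p - 2) * 3 ^ p
        * (L * diameter X ^ (p + 1) / real T powr ((real p + 1) / 2)
           + (\<Sum>i=1..p-1. \<delta> i * diameter X ^ (i + 1) / real T powr ((real i + 1) / 2)))"
proof -
  define \<theta> where "\<theta> = step_scale L \<delta> p"
  define r where "r k = norm (x k - v k)" for k
  define c :: real where "c = 1 / (4 * (5 * real p - 2))"
  define diam where "diam = diameter X"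
  have c: "c > 0" using p by (simp add: c_def)
  have dist_le: "norm (y - z) \<le> diam" if "y \<in> X" "z \<in> X" for y z
    using diameter_bounded_bound[OF X(3) that] by (simp add: diam_def dist_norm)

  \<comment> \<open>A one-point set is compatible with a negative \<open>L\<close>, but then only the value of the
    step scale at \<open>0\<close> matters.\<close>
  have L: "L \<ge> 0 \<or> (\<forall>y\<in>X. \<forall>z\<in>X. y = z)"
  proof (rule ccontr)
    assume "\<not> ?thesis"
    then obtain y z where yz: "y \<in> X" "z \<in> X" "y \<noteq> z" and neg: "L < 0" by auto
    have "multilinear d (p - 1) (\<lambda>hs. D (p - 1) y hs - D (p - 1) z hs)"
      using D yz by (intro multilinear_diff) (auto simp: derivatives_def)
    then have "0 \<le> L * norm (y - z)"
      using op_norm_nonneg lip[OF yz(1,2)] order_trans by blast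
    then show False using yz(3) neg by (simp add: zero_le_mult_iff)
  qed
  have \<theta>_nonneg: "\<theta> (norm (y - z)) \<ge> 0" if "y \<in> X" "z \<in> X" for y z
  proof (cases "L \<ge> 0")
    case True
    then show ?thesis unfolding \<theta>_def by (intro step_scale_nonneg \<delta>) auto
  next
    case False
    then have "y = z" using L that by blast
    moreover have "step_scale L \<delta> p 0 = step_scale 0 \<delta> p 0"
      using p by (simp add: step_scale_def)
    moreover have "step_scale 0 \<delta> p 0 \<ge> 0"
      by (intro step_scale_nonneg \<delta>) auto
    ultimately show ?thesis by (simp add: \<theta>_def)
  qed

  have x0: "x 0 \<in> X" and s0: "s 0 = 0"
    using run by (auto simp: VIHI_def)
  note iteration = run[unfolded VIHI_def, THEN conjunct2, THEN conjunct2, rule_format]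
  have vmax: "is_arg_max (\<lambda>u. s k \<bullet> (u - x 0) - 1/2 * norm (u - x 0) ^ 2) (\<lambda>u. u \<in> X) (v (Suc k))"
    and xX: "x (Suc k) \<in> X"
    and s: "s (Suc k) = s k - lam (Suc k) *\<^sub>R F (x (Suc k))" if "k < T" for k
    using iteration[OF that] by - (elim conjE, assumption)+
  have SUP_le: "(SUP y\<in>X. Omega F G L \<delta> (\<lambda>i. 5 * real p) p (v (Suc k)) (x (Suc k)) \<bullet> (x (Suc k) - y))
      \<le> \<theta> (r (Suc k)) * (r (Suc k))\<^sup>2" if "k < T" for k
  proof -
    have eq: "\<theta> (r (Suc k)) * (r (Suc k))\<^sup>2 = L / fact p * norm (x (Suc k) - v (Suc k)) ^ (p + 1)
        + (\<Sum>i=1..p-1. \<delta> i / fact i * norm (x (Suc k) - v (Suc k)) ^ (i + 1))"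
      using step_scale_times_square p by (simp add: \<theta>_def r_def)
    show ?thesis using iteration[OF that] unfolding eq by (elim conjE)
  qed
  have window: "c \<le> lam (Suc k) * \<theta> (r (Suc k))"
    "lam (Suc k) * \<theta> (r (Suc k)) \<le> 1 / (2 * (5 * real p + 1))" if "k < T" for k
    using iteration[OF that] unfolding \<theta>_def r_def step_scale_def c_def
    by - (elim conjE, assumption)+
  have vX: "v (Suc k) \<in> X" if "k < T" for k
    using vmax[OF that] by (simp add: is_arg_max_def)
  have \<theta>r: "\<theta> (r (Suc k)) \<ge> 0" if "k < T" for k
    unfolding r_def by (rule \<theta>_nonneg[OF xX[OF that] vX[OF that]])
  have lam_pos: "lam (Suc k) > 0" if "k < T" for k
  proof -
    have "lam (Suc k) * \<theta> (r (Suc k)) > 0" using window(1)[OF that] c by linarith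
    then show ?thesis using \<theta>r[OF that] by (auto simp: zero_less_mult_iff)
  qed

  have progress: "(lam (Suc k) *\<^sub>R F (x (Suc k))) \<bullet> (x (Suc k) - u) + (r (Suc k))\<^sup>2 / 8
      \<le> norm (u - v (Suc k)) ^ 2 / 2" if k: "k < T" and u: "u \<in> X" for k u
    unfolding r_def
  proof (rule regularized_step_progress)
    show "norm (F (x (Suc k)) - Psi F G p (v (Suc k)) (x (Suc k)))
        \<le> \<theta> (r (Suc k)) * norm (x (Suc k) - v (Suc k))"
      unfolding \<theta>_def r_def step_scale_def using p
      by (intro inexact_model_error[OF _ D X(1,4) lip G inexact vX[OF k] xX[OF k]]) auto
    have "Omega F G L \<delta> (\<lambda>i. 5 * real p) p (v (Suc k)) (x (Suc k)) \<bullet> (x (Suc k) - u)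
        \<le> \<theta> (r (Suc k)) * (r (Suc k))\<^sup>2"
      using cSUP_upper[OF u bdd_above_inner_diff[OF X(3)]] SUP_le[OF k] by (rule order_trans)
    then show "(Psi F G p (v (Suc k)) (x (Suc k))
          + (5 * real p * \<theta> (r (Suc k))) *\<^sub>R (x (Suc k) - v (Suc k))) \<bullet> (x (Suc k) - u)
        \<le> \<theta> (r (Suc k)) * norm (x (Suc k) - v (Suc k)) ^ 2"
      using p by (simp add: Omega_eq_step_scale \<theta>_def r_def)
    show "1 / (4 * (5 * real p - 2)) \<le> lam (Suc k) * \<theta> (r (Suc k))"
      using window(1)[OF k] by (simp add: c_def)
  qed (use window(2) \<theta>r lam_pos k p in \<open>auto simp: less_imp_le\<close>)

  have regret: "(\<Sum>k=1..T. (lam k *\<^sub>R F (x k)) \<bullet> (x k - u) + (r k)\<^sup>2 / 8) \<le> diam\<^sup>2 / 2"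
    if u: "u \<in> X" for u
  proof -
    have "(\<Sum>k=1..T. (lam k *\<^sub>R F (x k)) \<bullet> (x k - u) + (r k)\<^sup>2 / 8) \<le> norm (u - x 0) ^ 2 / 2"
      by (rule dual_extrapolation_regret[OF X(4,2) s0 vmax s progress u])
    also have "norm (u - x 0) ^ 2 \<le> diam\<^sup>2"
      using dist_le[OF u x0] by (intro power_mono) auto
    finally show ?thesis by simp
  qed
  have range: "P k" if "\<And>k. k < T \<Longrightarrow> P (Suc k)" "k \<in> {1..T}" for P k
    using that by (cases k) auto
  have xX': "x k \<in> X" and lam_pos': "lam k > 0" and window': "c \<le> lam k * \<theta> (r k)"
    if "k \<in> {1..T}" for k
    using range[of "\<lambda>k. x k \<in> X", OF xX that] range[of "\<lambda>k. lam k > 0", OF lam_pos that]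
      range[of "\<lambda>k. c \<le> lam k * \<theta> (r k)", OF window(1) that] by auto
  define xbar where "xbar = averaged_output T x lam"
  define \<Lambda> where "\<Lambda> = (\<Sum>k=1..T. lam k)"
  define gap where "gap = F w \<bullet> (xbar - w)"
  note defs = xbar_def averaged_output_def \<Lambda>_def gap_def
  have xbar: "xbar \<in> X"
    unfolding defs by (rule weighted_average_gap(1)[where F = F, OF X(4) xX' mono lam_pos' T regret])
  have sum_sq: "(\<Sum>k=1..T. (r k)\<^sup>2 / 8) \<le> diam\<^sup>2 / 2"
    by (rule weighted_average_gap(2)[where F = F, OF X(4) xX' mono lam_pos' T regret])
  have gap_sum: "\<Lambda> * gap + (\<Sum>k=1..T. (r k)\<^sup>2 / 8) \<le> diam\<^sup>2 / 2"
    unfolding defs by (rule weighted_average_gap(3)[where F = F, OF X(4) xX' mono lam_pos' T regret w])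
  have budget: "(\<Sum>k=1..T. (r k)\<^sup>2) \<le> 4 * diam\<^sup>2"
    using sum_sq by (simp flip: sum_divide_distrib)
  have "(\<Sum>k=1..T. (r k)\<^sup>2 / 8) \<ge> 0" by (intro sum_nonneg) auto
  then have gap_le: "\<Lambda> * gap \<le> diam\<^sup>2 / 2"
    using gap_sum by simp

  show ?thesis
  proof (cases "\<forall>y\<in>X. \<forall>z\<in>X. y = z")
    case True
    then have "xbar = w" and "X = {w}" using xbar w by auto
    then show ?thesis by (simp add: xbar_def)
  next
    case False
    then have L: "L \<ge> 0" using L by blast
    have diam: "diam > 0"
    proof -
      obtain y z where "y \<in> X" "z \<in> X" "y \<noteq> z" using False by blast
      then have "0 < norm (y - z)" "norm (y - z) \<le> diam" using dist_le by auto
      then show ?thesis by linarith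
    qed
    define \<Theta> where "\<Theta> = \<theta> (3 * diam / sqrt T)"
    have \<Theta>: "\<Theta> \<ge> 0"
      unfolding \<Theta>_def \<theta>_def using L diam by (intro step_scale_nonneg \<delta>) auto
    have low: "c * T / 2 \<le> \<Lambda> * \<Theta>"
      unfolding \<Lambda>_def \<Theta>_def
    proof (rule sum_stepsizes_lower_bound[where \<theta> = \<theta>, OF budget diam T window'])
      show "\<theta> a \<le> \<theta> b" if "0 \<le> a" "a \<le> b" for a b
        unfolding \<theta>_def using L that by (intro step_scale_mono \<delta>) auto
      show "\<theta> 0 \<ge> 0"
        unfolding \<theta>_def using L by (intro step_scale_nonneg \<delta>) auto
    qed (use lam_pos' c in \<open>auto simp: r_def less_imp_le\<close>)
    have rate: "diam\<^sup>2 / T * \<Theta>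
        \<le> 3 ^ p * (L * diam ^ (p + 1) / real T powr ((real p + 1) / 2)
           + (\<Sum>i=1..p-1. \<delta> i * diam ^ (i + 1) / real T powr ((real i + 1) / 2)))"
      unfolding \<Theta>_def \<theta>_def step_scale_def distrib_left sum_distrib_left
    proof (intro add_mono sum_mono rate_term)
      show "i \<in> {1..p-1} \<Longrightarrow> i \<le> p" for i by auto
    qed (use L \<delta> diam T p in auto)
    \<comment> \<open>The lower bound for the total weight may be multiplied only by a nonnegative gap.\<close>
    have "gap * c \<le> diam\<^sup>2 / T * \<Theta>"
    proof (cases "gap \<ge> 0")
      case True
      have "gap * (c * T / 2) \<le> gap * (\<Lambda> * \<Theta>)"
        using low True by (rule mult_left_mono)
      also have "\<dots> = (\<Lambda> * gap) * \<Theta>" by simp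
      also have "\<dots> \<le> diam\<^sup>2 / 2 * \<Theta>"
        using gap_le \<Theta> by (rule mult_right_mono)
      finally show ?thesis using T by (simp add: field_simps)
    next
      case False
      then have "gap * c \<le> 0" using c by (simp add: mult_le_0_iff)
      also have "0 \<le> diam\<^sup>2 / T * \<Theta>" using \<Theta> by simp
      finally show ?thesis .
    qed
    then have "gap \<le> (diam\<^sup>2 / T * \<Theta>) / c"
      using c by (simp only: pos_le_divide_eq)
    also have "\<dots> \<le> 3 ^ p * (L * diam ^ (p + 1) / real T powr ((real p + 1) / 2)
           + (\<Sum>i=1..p-1. \<delta> i * diam ^ (i + 1) / real T powr ((real i + 1) / 2))) / c"
      using rate c by (intro divide_right_mono) auto
    finally show ?thesis
      by (simp add: gap_def xbar_def diam_def c_def mult_ac)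
  qed
qed

theorem theorem7p2:
  fixes p :: nat
  assumes "p \<ge> 2"
  shows "\<exists>C::real. C > 0 \<and>
    (\<forall>(d::nat) (X::rvec set) (F::rvec \<Rightarrow> rvec)
       (D::nat \<Rightarrow> rvec \<Rightarrow> rvec list \<Rightarrow> rvec) (G::nat \<Rightarrow> rvec \<Rightarrow> rvec list \<Rightarrow> rvec)
       (L::real) (\<delta>::nat \<Rightarrow> real) (T::nat)
       (x::nat \<Rightarrow> rvec) (v::nat \<Rightarrow> rvec) (s::nat \<Rightarrow> rvec) (lam::nat \<Rightarrow> real).
       X \<subseteq> Rd d \<and> X \<noteq> {} \<and> closed X \<and> bounded X \<and> convex X \<and>
       F ` X \<subseteq> Rd d \<and>
       (\<forall>y\<in>X. \<forall>z\<in>X. (F y - F z) \<bullet> (y - z) \<ge> 0) \<and>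
       derivatives d X (p - 1) F D \<and>
       (\<forall>y\<in>X. \<forall>z\<in>X.
          op_norm d (p - 1) (\<lambda>hs. D (p - 1) y hs - D (p - 1) z hs) \<le> L * norm (y - z)) \<and>
       (\<forall>i\<in>{1..p-1}. \<delta> i \<ge> 0) \<and>
       (\<forall>i\<in>{1..p-1}. \<forall>u\<in>X. multilinear d i (G i u)) \<and>
       (\<forall>i\<in>{1..p-1}. \<forall>y\<in>X. \<forall>u\<in>X.
          op_norm d 1 (\<lambda>hs. D i u (replicate (i - 1) (y - u) @ hs)
                           - G i u (replicate (i - 1) (y - u) @ hs))
            \<le> \<delta> i * norm (y - u) ^ (i - 1)) \<and>
       T \<ge> 1 \<and>
       VIHI X F G L \<delta> (\<lambda>i. 5 * real p) p T x v s lam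
       \<longrightarrow>
       (SUP y\<in>X. F y \<bullet> (averaged_output T x lam - y))
         \<le> C * (L * diameter X ^ (p + 1) / real T powr ((real p + 1) / 2)
               + (\<Sum>i=1..p-1. \<delta> i * diameter X ^ (i + 1) / real T powr ((real i + 1) / 2))))"
  proof (intro exI conjI allI impI; (elim conjE)?)
  show "0 < 4 * (5 * real p - 2) * 3 ^ p"
    using assms by simp
next
  fix d X F D G L \<delta> T x v s lam
  assume X: "X \<subseteq> Rd d" "closed X" "bounded X" "convex X" and ne: "X \<noteq> {}"
    and hyps: "\<forall>y\<in>X. \<forall>z\<in>X. (F y - F z) \<bullet> (y - z) \<ge> 0"
      "derivatives d X (p - 1) F D"
      "\<forall>y\<in>X. \<forall>z\<in>X.
          op_norm d (p - 1) (\<lambda>hs. D (p - 1) y hs - D (p - 1) z hs) \<le> L * norm (y - z)"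
      "\<forall>i\<in>{1..p-1}. \<delta> i \<ge> 0"
      "\<forall>i\<in>{1..p-1}. \<forall>u\<in>X. multilinear d i (G i u)"
      "\<forall>i\<in>{1..p-1}. \<forall>y\<in>X. \<forall>u\<in>X.
          op_norm d 1 (\<lambda>hs. D i u (replicate (i - 1) (y - u) @ hs)
                           - G i u (replicate (i - 1) (y - u) @ hs))
            \<le> \<delta> i * norm (y - u) ^ (i - 1)"
      "T \<ge> 1"
      "VIHI X F G L \<delta> (\<lambda>i. 5 * real p) p T x v s lam"
  show "(SUP y\<in>X. F y \<bullet> (averaged_output T x lam - y))
    \<le> 4 * (5 * real p - 2) * 3 ^ p
        * (L * diameter X ^ (p + 1) / real T powr ((real p + 1) / 2)
           + (\<Sum>i=1..p-1. \<delta> i * diameter X ^ (i + 1) / real T powr ((real i + 1) / 2)))"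
    using ne
  proof (rule cSUP_least)
    fix w assume w: "w \<in> X"
    show "F w \<bullet> (averaged_output T x lam - w)
      \<le> 4 * (5 * real p - 2) * 3 ^ p
          * (L * diameter X ^ (p + 1) / real T powr ((real p + 1) / 2)
             + (\<Sum>i=1..p-1. \<delta> i * diameter X ^ (i + 1) / real T powr ((real i + 1) / 2)))"
      by (rule VIHI_gap_bound[OF assms X _ hyps(2) _ _ _ _ hyps(7,8) w]) (use hyps in blast)+
  qed
qed

end
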